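(* Let $(\Omega,\Sigma,P)$ be a probability space, $(\Psi,Z)$ a measurable space, $\Theta:\Omega\to\Psi$ a $\Sigma$-$Z$-measurable map, and $\{P_\theta\}_{\theta\in\Psi}$ a disintegration of $P$ over $P_\Theta$ consistent with $\Theta$. Let $\{N_t\}_{t\in\mathbb{R}_+}$ be a counting process on $(\Omega,\Sigma)$ and let $\{\widetilde{\mathbf{K}}_t\}_{t\in\mathbb{R}_+}$ be a family of Markov kernels from $(\Psi,Z)$ to $([0,\infty],\mathfrak{B}([0,\infty]))$ such that $t\mapsto\widetilde{\mathbf{K}}_t(\theta)(B)$ is continuous for any fixed $B\in\mathfrak{B}([0,\infty])$ and $\theta\in\Psi$. Then $\{N_t\}_{t\in\mathbb{R}_+}$ has $P$-conditionally (given $\Theta$) stationary independent increments such that $$P_{N_t\mid\Theta}=\widetilde{\mathbf{K}}_t(\Theta)\quad P\mid\sigma(\Theta)\text{-a.s.}$$ holds for each $t\in\mathbb{R}_+$ if and only if for $P_\Theta$-almost all $\theta\in\Psi$ it has $P_\theta$-stationary independent increments such that $(P_\theta)_{N_t}=\widetilde{\mathbf{K}}_t(\theta)$ for each $t\in\mathbb{R}_+$.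
   Context: $P_\Theta:=P\circ\Theta^{-1}$ on $Z$. A disintegration of $P$ over $P_\Theta$ consistent with $\Theta$ is a family $\{P_\theta\}_{\theta\in\Psi}$ of probability measures on $\Sigma$ such that $\theta\mapsto P_\theta(D)$ is $Z$-measurable and $\int P_\theta(D)\,P_\Theta(d\theta)=P(D)$ for each $D\in\Sigma$, and for each $B\in Z$ one has $P_\theta(\Theta^{-1}(B))=1$ for $P_\Theta$-almost every $\theta\in B$. Counting process: a family $\{N_t\}_{t\in\mathbb{R}_+}$ of $\Sigma$-measurable maps such that every path takes values in $\mathbb{N}_0\cup\{\infty\}$, vanishes at $t=0$, is nondecreasing and right-continuous, has jumps of size at most one ($N_t\le\sup_{s<t}N_s+1$ for $t>0$) and increases to infinity ($\sup_tN_t=\infty$); the exceptional null set is assumed empty. Conditional independence of a family $\{X_i\}_{i\in I}$ given $\Theta$: for each $n\ge2$, distinct $i_1,\dots,i_n$ and $E_j\in\sigma(X_{i_j})$, $P(\bigcap_jE_j\mid\sigma(\Theta))=\prod_jP(E_j\mid\sigma(\Theta))$ a.s. $\{N_t\}$ has (conditionally) independent increments if for each $m\in\mathbb{N}$ and $0=t_0<t_1<\dots<t_m$ the increments $N_{t_j}-N_{t_{j-1}}$, $1\le j\le m$, are (conditionally given $\Theta$) independent; it has (conditionally) stationary increments if for all such $m,t_0,\dots,t_m$ and all $h\in\mathbb{R}_+$ the vectors $(N_{t_j+h}-N_{t_{j-1}+h})_{1\le j\le m}$ and $(N_{t_j}-N_{t_{j-1}})_{1\le j\le m}$ have the same (conditional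 given $\Theta$) joint distribution. Convention: $\infty-\infty:=0$. $P_{N_t\mid\Theta}$ is a conditional distribution of $N_t$ given $\Theta$: a Markov kernel, $\sigma(\Theta)$-measurable in $\omega$, with $P_{N_t\mid\Theta}(B,\cdot)=P(N_t^{-1}(B)\mid\sigma(\Theta))$ a.s. for each $B$. $\widetilde{\mathbf{K}}_t(\Theta)(B,\omega):=\widetilde{\mathbf{K}}_t(\Theta(\omega))(B)$. Kernels are equal $P\mid\sigma(\Theta)$-a.s. if there is a $P$-null set in $\sigma(\Theta)$ outside of which they agree for all $B$. $(P_\theta)_{N_t}:=P_\theta\circ N_t^{-1}$. *)

theory Defs
  imports "HOL-Probability.Probability"
begin

text \<open>
  The time set is the set \<open>{0..}\<close> of nonnegative reals; families indexed by time are
  functions on \<^typ>\<open>real\<close> of which only the values at nonnegative arguments matter.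
  The space \<open>[0,\<infinity>]\<close> with its Borel sets is \<open>borel :: ennreal measure\<close>.  A Markov kernel from
  \<open>M\<close> to \<open>L\<close> is a measurable map from \<open>M\<close> to \<open>prob_algebra L\<close>.
\<close>

definition disintegration ::
    "'a measure \<Rightarrow> 'b measure \<Rightarrow> ('a \<Rightarrow> 'b) \<Rightarrow> ('b \<Rightarrow> 'a measure) \<Rightarrow> bool" where
  "disintegration P Z \<Theta> Q \<longleftrightarrow>
     Q \<in> Z \<rightarrow>\<^sub>M prob_algebra P \<and>
     (\<forall>D\<in>sets P. (\<integral>\<^sup>+\<theta>. emeasure (Q \<theta>) D \<partial>distr P Z \<Theta>) = emeasure P D) \<and>
     (\<forall>B\<in>sets Z. AE \<theta> in distr P Z \<Theta>. \<theta> \<in> B \<longrightarrow> emeasure (Q \<theta>) (\<Theta> -` B \<inter> space P) = 1)"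

definition counting_process :: "'a measure \<Rightarrow> (real \<Rightarrow> 'a \<Rightarrow> ennreal) \<Rightarrow> bool" where
  "counting_process M N \<longleftrightarrow>
     (\<forall>t\<ge>0. N t \<in> borel_measurable M) \<and>
     (\<forall>\<omega>\<in>space M.
        (\<forall>t\<ge>0. N t \<omega> \<in> range of_nat \<union> {\<infinity>}) \<and>
        N 0 \<omega> = 0 \<and>
        mono_on {0..} (\<lambda>t. N t \<omega>) \<and>
        (\<forall>t\<ge>0. continuous (at_right t) (\<lambda>s. N s \<omega>)) \<and>
        (\<forall>t>0. N t \<omega> \<le> (SUP s\<in>{0..<t}. N s \<omega>) + 1) \<and>
        (SUP t\<in>{0..}. N t \<omega>) = \<infinity>)"

text \<open>
  Difference with the convention \<open>\<infinity> - \<infinity> = 0\<close>; the subtraction on \<^typ>\<open>ennreal\<close>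
  has \<open>\<infinity> - \<infinity> = \<infinity>\<close>.
\<close>

definition ext_diff :: "ennreal \<Rightarrow> ennreal \<Rightarrow> ennreal" where
  "ext_diff x y = (if x = \<infinity> \<and> y = \<infinity> then 0 else x - y)"

definition time_grid :: "nat \<Rightarrow> (nat \<Rightarrow> real) \<Rightarrow> bool" where
  "time_grid m t \<longleftrightarrow> 1 \<le> m \<and> t 0 = 0 \<and> (\<forall>j<m. t j < t (Suc j))"

text \<open>
  Increments are numbered from \<open>1\<close>; \<open>h\<close> shifts the whole grid \<open>t\<close>.
\<close>

definition increment ::
    "(real \<Rightarrow> 'a \<Rightarrow> ennreal) \<Rightarrow> (nat \<Rightarrow> real) \<Rightarrow> real \<Rightarrow> nat \<Rightarrow> 'a \<Rightarrow> ennreal" where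
  "increment N t h j \<omega> = ext_diff (N (t j + h) \<omega>) (N (t (j - 1) + h) \<omega>)"

definition increment_vector ::
    "(real \<Rightarrow> 'a \<Rightarrow> ennreal) \<Rightarrow> nat \<Rightarrow> (nat \<Rightarrow> real) \<Rightarrow> real \<Rightarrow> 'a \<Rightarrow> nat \<Rightarrow> ennreal" where
  "increment_vector N m t h \<omega> = (\<lambda>j\<in>{1..m}. increment N t h j \<omega>)"

definition independent_increments :: "'a measure \<Rightarrow> (real \<Rightarrow> 'a \<Rightarrow> ennreal) \<Rightarrow> bool" where
  "independent_increments P N \<longleftrightarrow>
     (\<forall>m t. time_grid m t \<longrightarrow>
        prob_space.indep_vars P (\<lambda>_. borel) (increment N t 0) {1..m})"

definition stationary_increments :: "'a measure \<Rightarrow> (real \<Rightarrow> 'a \<Rightarrow> ennreal) \<Rightarrow> bool" where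
  "stationary_increments P N \<longleftrightarrow>
     (\<forall>m t h. time_grid m t \<longrightarrow> 0 \<le> h \<longrightarrow>
        distr P (\<Pi>\<^sub>M j\<in>{1..m}. borel) (increment_vector N m t h) =
        distr P (\<Pi>\<^sub>M j\<in>{1..m}. borel) (increment_vector N m t 0))"

definition sigma_gen :: "'a measure \<Rightarrow> 'b measure \<Rightarrow> ('a \<Rightarrow> 'b) \<Rightarrow> 'a measure" where
  "sigma_gen P Z \<Theta> = vimage_algebra (space P) \<Theta> Z"

definition cond_probability :: "'a measure \<Rightarrow> 'a measure \<Rightarrow> 'a set \<Rightarrow> 'a \<Rightarrow> real" where
  "cond_probability P F E = real_cond_exp P F (indicator E)"

definition cond_indep_vars ::
    "'a measure \<Rightarrow> 'a measure \<Rightarrow> ('i \<Rightarrow> 'c measure) \<Rightarrow> ('i \<Rightarrow> 'a \<Rightarrow> 'c) \<Rightarrow> 'i set \<Rightarrow> bool" where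
  "cond_indep_vars P F M' X I \<longleftrightarrow>
     (\<forall>i\<in>I. X i \<in> P \<rightarrow>\<^sub>M M' i) \<and>
     (\<forall>J E. J \<subseteq> I \<longrightarrow> finite J \<longrightarrow> 2 \<le> card J \<longrightarrow>
        (\<forall>j\<in>J. E j \<in> sets (sigma_gen P (M' j) (X j))) \<longrightarrow>
        (AE \<omega> in P. cond_probability P F (\<Inter>j\<in>J. E j) \<omega> = (\<Prod>j\<in>J. cond_probability P F (E j) \<omega>)))"

definition is_cond_distr ::
    "'a measure \<Rightarrow> 'a measure \<Rightarrow> 'c measure \<Rightarrow> ('a \<Rightarrow> 'c) \<Rightarrow> ('a \<Rightarrow> 'c measure) \<Rightarrow> bool" where
  "is_cond_distr P F M' X k \<longleftrightarrow>
     k \<in> F \<rightarrow>\<^sub>M prob_algebra M' \<and>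
     (\<forall>B\<in>sets M'. AE \<omega> in P. measure (k \<omega>) B = cond_probability P F (X -` B \<inter> space P) \<omega>)"

text \<open>
  Almost sure equality with respect to \<open>P\<close> restricted to \<open>F\<close>: the exceptional \<open>P\<close>-null set lies
  in \<open>F\<close> and does not depend on the measurable set at which the kernels are evaluated.
\<close>

definition kernels_eq_AE ::
    "'a measure \<Rightarrow> 'a measure \<Rightarrow> 'c measure \<Rightarrow> ('a \<Rightarrow> 'c measure) \<Rightarrow> ('a \<Rightarrow> 'c measure) \<Rightarrow> bool" where
  "kernels_eq_AE P F M' k l \<longleftrightarrow>
     (AE \<omega> in restr_to_subalg P F. \<forall>B\<in>sets M'. measure (k \<omega>) B = measure (l \<omega>) B)"

definition cond_independent_increments ::
    "'a measure \<Rightarrow> 'b measure \<Rightarrow> ('a \<Rightarrow> 'b) \<Rightarrow> (real \<Rightarrow> 'a \<Rightarrow> ennreal) \<Rightarrow> bool" where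
  "cond_independent_increments P Z \<Theta> N \<longleftrightarrow>
     (\<forall>m t. time_grid m t \<longrightarrow>
        cond_indep_vars P (sigma_gen P Z \<Theta>) (\<lambda>_. borel) (increment N t 0) {1..m})"

definition cond_stationary_increments ::
    "'a measure \<Rightarrow> 'b measure \<Rightarrow> ('a \<Rightarrow> 'b) \<Rightarrow> (real \<Rightarrow> 'a \<Rightarrow> ennreal) \<Rightarrow> bool" where
  "cond_stationary_increments P Z \<Theta> N \<longleftrightarrow>
     (\<forall>m t h. time_grid m t \<longrightarrow> 0 \<le> h \<longrightarrow>
        (\<exists>k l. is_cond_distr P (sigma_gen P Z \<Theta>) (\<Pi>\<^sub>M j\<in>{1..m}. borel) (increment_vector N m t h) k \<and>
               is_cond_distr P (sigma_gen P Z \<Theta>) (\<Pi>\<^sub>M j\<in>{1..m}. borel) (increment_vector N m t 0) l \<and>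
               kernels_eq_AE P (sigma_gen P Z \<Theta>) (\<Pi>\<^sub>M j\<in>{1..m}. borel) k l))"

end

theory Submission
  imports Defs
begin

text \<open>
  By consistency of the disintegration, \<open>P(D | \<sigma>(\<Theta>))\<close> agrees almost surely with \<open>\<omega> \<mapsto> Q (\<Theta> \<omega>) D\<close>
  for each single event \<open>D\<close>.  This yields the conditional properties from the pointwise ones at once.  For the converse,
  all increments take values in the countable set \<open>{0, 1, 2, \<dots>, \<infinity>}\<close>, so their joint laws are given
  by point masses, and countably many identities suffice on rational time grids; these hold outside
  one common null set.  They extend to real grids by approximation from above: right-continuity
  makes the increments eventually constant along the approximation, path by path, so the
  probabilities of arbitrary events converge, and \<open>t \<mapsto> K t \<theta> B\<close> is continuous by assumption.
\<close>

subsection \<open>Laws with countable support\<close>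

text \<open>Countable additivity extends the agreement of point masses to all subsets of
  \<open>A\<close>. Only \<open>M\<close> is assumed to be concentrated on \<open>A\<close>;
  \<open>N\<close> inherits this because \<open>N\<close> gives \<open>A\<close> the same mass,
  which is 1.\<close>

lemma prob_measure_eqI_countable:
  assumes "prob_space M" "prob_space N" "sets M = sets N"
    and A: "countable A" "\<And>a. a \<in> A \<Longrightarrow> {a} \<in> sets M"
    and M: "AE x in M. x \<in> A"
    and eq: "\<And>a. a \<in> A \<Longrightarrow> measure M {a} = measure N {a}"
  shows "M = N"
proof (rule measure_eqI)
  interpret M: prob_space M by fact
  interpret N: prob_space N by fact
  have sets: "X \<in> sets M" if "X \<subseteq> A" for X
  proof -
    have "countable X" using that A(1) countable_subset by blast
    then show ?thesis using A(2) that by (auto intro: sets.countable[of X M])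
  qed
  have eqA: "emeasure M X = emeasure N X" if "X \<subseteq> A" for X
  proof -
    have "countable X" using that A(1) countable_subset by blast
    then have "emeasure M X = (\<integral>\<^sup>+x. emeasure M {x} \<partial>count_space X)"
      using A that by (intro emeasure_countable_singleton) auto
    also have "\<dots> = (\<integral>\<^sup>+x. emeasure N {x} \<partial>count_space X)"
      using that eq by (intro nn_integral_cong) (auto simp: M.emeasure_eq_measure N.emeasure_eq_measure)
    also have "\<dots> = emeasure N X"
      using A that \<open>countable X\<close> \<open>sets M = sets N\<close>
      by (intro emeasure_countable_singleton[symmetric]) auto
    finally show ?thesis .
  qed
  have "emeasure M A = 1"
    using M sets[of A] M.emeasure_eq_1_AE by blast
  then have "emeasure N A = 1" using eqA[of A] by simp
  then have N: "AE x in N. x \<in> A"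
    using sets[of A] \<open>sets M = sets N\<close> N.AE_in_set_eq_1[of A] by (simp add: N.emeasure_eq_measure)
  fix X assume X: "X \<in> sets M"
  have "emeasure M X = emeasure M (X \<inter> A)"
    using X sets[of "X \<inter> A"] M by (intro emeasure_eq_AE) auto
  also have "\<dots> = emeasure N (X \<inter> A)" using eqA[of "X \<inter> A"] by simp
  also have "\<dots> = emeasure N X"
    using X sets[of "X \<inter> A"] N \<open>sets M = sets N\<close> by (intro emeasure_eq_AE) auto
  finally show "emeasure M X = emeasure N X" .
qed fact

text \<open>The indicators are eventually constant at each point, from an index that may depend on
  \<open>\<omega>\<close>, so dominated convergence with bound 1 applies.\<close>

lemma (in prob_space) prob_tendsto_eventually:
  assumes "\<And>n. A n \<in> events" "B \<in> events"
    and "\<And>\<omega>. \<omega> \<in> space M \<Longrightarrow> eventually (\<lambda>n. \<omega> \<in> A n \<longleftrightarrow> \<omega> \<in> B) sequentially"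
  shows "(\<lambda>n. prob (A n)) \<longlonglongrightarrow> prob B"
proof -
  have "(\<lambda>n. \<integral>\<omega>. indicat_real (A n) \<omega> \<partial>M) \<longlonglongrightarrow> (\<integral>\<omega>. indicat_real B \<omega> \<partial>M)"
  proof (rule integral_dominated_convergence[where w="\<lambda>_. 1"])
    show "AE \<omega> in M. (\<lambda>n. indicat_real (A n) \<omega>) \<longlonglongrightarrow> indicat_real B \<omega>"
    proof (rule AE_I2)
      fix \<omega> assume "\<omega> \<in> space M"
      from assms(3)[OF this] have "eventually (\<lambda>n. indicat_real (A n) \<omega> = indicat_real B \<omega>) sequentially"
        by eventually_elim (auto simp: indicator_def)
      then show "(\<lambda>n. indicat_real (A n) \<omega>) \<longlonglongrightarrow> indicat_real B \<omega>"
        by (rule tendsto_eventually)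
    qed
  qed (use assms in \<open>auto intro!: borel_measurable_indicator simp: indicator_def\<close>)
  then show ?thesis using assms by simp
qed

lemma PiM_borel_singleton:
  fixes c :: "'i \<Rightarrow> 'b::t1_space"
  assumes "finite I" "c \<in> extensional I"
  shows "{c} \<in> sets (\<Pi>\<^sub>M i\<in>I. borel)" and "{c} = (\<Pi>\<^sub>E i\<in>I. {c i})"
proof -
  show *: "{c} = (\<Pi>\<^sub>E i\<in>I. {c i})"
    using assms(2) by (auto simp: PiE_singleton)
  show "{c} \<in> sets (\<Pi>\<^sub>M i\<in>I. borel)"
    unfolding * using assms(1) by (intro sets_PiM_I_finite) auto
qed

lemma AE_distr_PiE_countable:
  fixes X :: "'i \<Rightarrow> 'a \<Rightarrow> 'b::t1_space"
  assumes I: "finite I"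
    and rv[measurable]: "\<And>i. i \<in> I \<Longrightarrow> X i \<in> borel_measurable M"
    and C: "countable C" "\<And>i \<omega>. i \<in> I \<Longrightarrow> \<omega> \<in> space M \<Longrightarrow> X i \<omega> \<in> C"
  shows "AE x in distr M (\<Pi>\<^sub>M i\<in>I. borel) (\<lambda>\<omega>. \<lambda>i\<in>I. X i \<omega>). x \<in> I \<rightarrow>\<^sub>E C"
proof -
  have "C \<in> sets borel" using C(1) by (rule sets.countable[rotated]) auto
  then have "I \<rightarrow>\<^sub>E C \<in> sets (\<Pi>\<^sub>M i\<in>I. borel)"
    using I by (intro sets_PiM_I_finite)
  then have "{x \<in> space (\<Pi>\<^sub>M i\<in>I. borel). x \<in> I \<rightarrow>\<^sub>E C} \<in> sets (\<Pi>\<^sub>M i\<in>I. borel)"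
    using sets.Int_space_eq1[of "I \<rightarrow>\<^sub>E C" "\<Pi>\<^sub>M i\<in>I. borel"] by (simp add: Collect_conj_eq)
  moreover have "(\<lambda>\<omega>. \<lambda>i\<in>I. X i \<omega>) \<in> M \<rightarrow>\<^sub>M (\<Pi>\<^sub>M i\<in>I. borel)" by measurable
  ultimately show ?thesis
    using C by (subst AE_distr_iff) auto
qed

text \<open>Independence means that the joint law is the product of the marginals, and two laws on
  the countable set of value vectors are compared through their point masses.\<close>

lemma (in prob_space) indep_vars_countableI:
  fixes X :: "'i \<Rightarrow> 'a \<Rightarrow> 'b::t1_space"
  assumes I: "finite I" "I \<noteq> {}"
    and rv[measurable]: "\<And>i. i \<in> I \<Longrightarrow> random_variable borel (X i)"
    and C: "countable C" "\<And>i \<omega>. i \<in> I \<Longrightarrow> \<omega> \<in> space M \<Longrightarrow> X i \<omega> \<in> C"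
    and eq: "\<And>c. c \<in> I \<rightarrow>\<^sub>E C \<Longrightarrow>
      prob {\<omega>\<in>space M. \<forall>i\<in>I. X i \<omega> = c i} = (\<Prod>i\<in>I. prob {\<omega>\<in>space M. X i \<omega> = c i})"
  shows "indep_vars (\<lambda>_. borel) X I"
proof -
  let ?X = "\<lambda>\<omega>. \<lambda>i\<in>I. X i \<omega>"
  \<comment> \<open>The product locale asks for a probability measure at every index. Outside
    \<open>I\<close> the map \<open>X i\<close> need not be measurable, so a Dirac measure serves as
    filler; \<open>PiM_cong\<close> removes it at the end.\<close>
  let ?D = "\<lambda>i. if i \<in> I then distr M borel (X i) else return borel undefined"
  have X[measurable]: "?X \<in> M \<rightarrow>\<^sub>M (\<Pi>\<^sub>M i\<in>I. borel)" by measurable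
  have D: "prob_space (?D i)" for i
    using prob_space_distr[OF rv] by (auto intro: prob_space_return)
  interpret D: product_prob_space ?D I
    by (intro product_prob_spaceI D)
  interpret D: finite_product_prob_space ?D I
    by standard (rule I)
  have "distr M (\<Pi>\<^sub>M i\<in>I. borel) ?X = (\<Pi>\<^sub>M i\<in>I. ?D i)"
  proof (rule prob_measure_eqI_countable[where A="I \<rightarrow>\<^sub>E C"])
    show "prob_space (distr M (\<Pi>\<^sub>M i\<in>I. borel) ?X)" by (rule prob_space_distr) fact
    show "prob_space (\<Pi>\<^sub>M i\<in>I. ?D i)" by standard (rule D.emeasure_space_1)
    show "sets (distr M (\<Pi>\<^sub>M i\<in>I. borel) ?X) = sets (\<Pi>\<^sub>M i\<in>I. ?D i)"
      by (simp add: sets_PiM_cong[OF refl, of I ?D "\<lambda>_. borel"])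
    show "countable (I \<rightarrow>\<^sub>E C)" using I C by (intro countable_PiE)
    have sets: "{c} \<in> sets (\<Pi>\<^sub>M i\<in>I. (borel :: 'b measure))" if "c \<in> I \<rightarrow>\<^sub>E C" for c
      using that I by (intro PiM_borel_singleton) (auto simp: PiE_def)
    then show "{c} \<in> sets (distr M (\<Pi>\<^sub>M i\<in>I. borel) ?X)" if "c \<in> I \<rightarrow>\<^sub>E C" for c
      using that by simp
    show "AE x in distr M (\<Pi>\<^sub>M i\<in>I. borel) ?X. x \<in> I \<rightarrow>\<^sub>E C"
      by (rule AE_distr_PiE_countable) fact+
    fix c assume c: "c \<in> I \<rightarrow>\<^sub>E C"
    have "measure (distr M (\<Pi>\<^sub>M i\<in>I. borel) ?X) {c} = prob (?X -` {c} \<inter> space M)"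
      using sets[OF c] by (intro measure_distr X)
    also have "?X -` {c} \<inter> space M = {\<omega>\<in>space M. \<forall>i\<in>I. X i \<omega> = c i}"
      using c by (auto simp: PiE_iff extensional_def fun_eq_iff restrict_def)
    also have "prob \<dots> = (\<Prod>i\<in>I. prob {\<omega>\<in>space M. X i \<omega> = c i})" using eq[OF c] .
    also have "\<dots> = (\<Prod>i\<in>I. measure (?D i) {c i})"
      by (intro prod.cong refl) (auto simp: measure_distr vimage_def Int_def conj_commute)
    also have "\<dots> = measure (\<Pi>\<^sub>M i\<in>I. ?D i) (\<Pi>\<^sub>E i\<in>I. {c i})"
      by (rule D.prob_times[symmetric]) auto
    also have "(\<Pi>\<^sub>E i\<in>I. {c i}) = {c}"
      using c I by (intro PiM_borel_singleton(2)[symmetric]) (auto simp: PiE_def)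
    finally show "measure (distr M (\<Pi>\<^sub>M i\<in>I. borel) ?X) {c} = measure (\<Pi>\<^sub>M i\<in>I. ?D i) {c}" .
  qed
  also have "(\<Pi>\<^sub>M i\<in>I. ?D i) = (\<Pi>\<^sub>M i\<in>I. distr M borel (X i))"
    by (intro PiM_cong) auto
  finally show ?thesis
    using I rv by (subst indep_vars_iff_distr_eq_PiM') auto
qed

text \<open>Only \<open>X\<close> is required to take values in \<open>C\<close>: equality of the
  point masses forces the law of \<open>Y\<close> onto the same countable set.\<close>

lemma (in prob_space) distr_PiM_eq_countableI:
  fixes X Y :: "'i \<Rightarrow> 'a \<Rightarrow> 'b::t1_space"
  assumes I: "finite I"
    and rv[measurable]: "\<And>i. i \<in> I \<Longrightarrow> random_variable borel (X i)" "\<And>i. i \<in> I \<Longrightarrow> random_variable borel (Y i)"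
    and C: "countable C" "\<And>i \<omega>. i \<in> I \<Longrightarrow> \<omega> \<in> space M \<Longrightarrow> X i \<omega> \<in> C"
    and eq: "\<And>c. c \<in> I \<rightarrow>\<^sub>E C \<Longrightarrow>
      prob {\<omega>\<in>space M. \<forall>i\<in>I. X i \<omega> = c i} = prob {\<omega>\<in>space M. \<forall>i\<in>I. Y i \<omega> = c i}"
  shows "distr M (\<Pi>\<^sub>M i\<in>I. borel) (\<lambda>\<omega>. \<lambda>i\<in>I. X i \<omega>) = distr M (\<Pi>\<^sub>M i\<in>I. borel) (\<lambda>\<omega>. \<lambda>i\<in>I. Y i \<omega>)"
    (is "distr M ?B ?X = distr M ?B ?Y")
proof (rule prob_measure_eqI_countable[where A="I \<rightarrow>\<^sub>E C"])
  have X[measurable]: "?X \<in> M \<rightarrow>\<^sub>M ?B" and Y[measurable]: "?Y \<in> M \<rightarrow>\<^sub>M ?B" by measurable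
  show "prob_space (distr M ?B ?X)" "prob_space (distr M ?B ?Y)" by (rule prob_space_distr; fact)+
  show "countable (I \<rightarrow>\<^sub>E C)" using I C by (intro countable_PiE)
  have sets: "{c} \<in> sets ?B" if "c \<in> I \<rightarrow>\<^sub>E C" for c
    using that I by (intro PiM_borel_singleton) (auto simp: PiE_def)
  then show "{c} \<in> sets (distr M ?B ?X)" if "c \<in> I \<rightarrow>\<^sub>E C" for c
    using that by simp
  show "AE x in distr M ?B ?X. x \<in> I \<rightarrow>\<^sub>E C"
    by (rule AE_distr_PiE_countable) fact+
  fix c assume c: "c \<in> I \<rightarrow>\<^sub>E C"
  have vim: "(\<lambda>\<omega>. \<lambda>i\<in>I. V i \<omega>) -` {c} \<inter> space M = {\<omega>\<in>space M. \<forall>i\<in>I. V i \<omega> = c i}" for V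
    using c by (auto simp: PiE_iff extensional_def fun_eq_iff restrict_def)
  show "measure (distr M ?B ?X) {c} = measure (distr M ?B ?Y) {c}"
    using sets[OF c] eq[OF c] by (simp add: measure_distr[OF X] measure_distr[OF Y] vim)
qed simp

subsection \<open>Increments of counting processes\<close>

definition count_values :: "ennreal set" where
  "count_values = range of_nat \<union> {\<infinity>}"

lemma countable_count_values: "countable count_values"
  by (simp add: count_values_def)

text \<open>Finite differences truncate at 0, a finite value minus infinity is 0, infinity minus a
  finite value is infinity, and the remaining case is 0 by convention.\<close>

lemma ext_diff_count_values:
  assumes "x \<in> count_values" "y \<in> count_values"
  shows "ext_diff x y \<in> count_values"
proof -
  \<comment> \<open>Subtraction truncates at 0 both on \<open>nat\<close> and on
    \<open>ennreal\<close>, so the identity also holds for \<open>a < b\<close>.\<close>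
  have "(of_nat a :: ennreal) - of_nat b = of_nat (a - b)" for a b
    by (cases "b \<le> a") (auto simp: ennreal_of_nat_eq_real_of_nat ennreal_minus ennreal_neg)
  moreover have "(of_nat a :: ennreal) - \<top> = of_nat 0" for a
    by (simp add: diff_eq_0_iff_ennreal of_nat_less_top)
  ultimately show ?thesis
    using assms by (auto simp: count_values_def ext_diff_def simp del: of_nat_0)
qed

lemma measurable_ext_diff[measurable (raw)]:
  assumes [measurable]: "f \<in> borel_measurable M" "g \<in> borel_measurable M"
  shows "(\<lambda>x. ext_diff (f x) (g x)) \<in> borel_measurable M"
  unfolding ext_diff_def by measurable

lemma time_grid_mono:
  assumes "time_grid m t" "i \<le> j" "j \<le> m"
  shows "t i \<le> t j"
  using assms(2,3)
proof (induction rule: dec_induct)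
  case (step k)
  then have "t k < t (Suc k)" "t i \<le> t k" using assms(1) by (auto simp: time_grid_def)
  then show ?case by simp
qed simp

lemma time_grid_nonneg: "time_grid m t \<Longrightarrow> j \<le> m \<Longrightarrow> 0 \<le> t j"
  using time_grid_mono[of m t 0 j] by (simp add: time_grid_def)

text \<open>The notion depends on \<open>M\<close> only through its space and its measurable sets.
  The locale can therefore be entered again for each measure \<open>Q \<theta>\<close>.\<close>

locale counting =
  fixes M :: "'a measure" and N :: "real \<Rightarrow> 'a \<Rightarrow> ennreal"
  assumes counting: "counting_process M N"
begin

lemma measurable_N: "0 \<le> t \<Longrightarrow> N t \<in> borel_measurable M"
  using counting by (simp add: counting_process_def)

lemma N_values: "0 \<le> t \<Longrightarrow> \<omega> \<in> space M \<Longrightarrow> N t \<omega> \<in> count_values"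
  using counting by (auto simp: counting_process_def count_values_def)

text \<open>The points \<open>t i\<close> are only assumed nonnegative, not strictly increasing,
  because rounding up a time grid can merge neighbouring points when the mesh is coarse.\<close>

lemma measurable_increment:
  assumes "\<And>i. i \<le> m \<Longrightarrow> 0 \<le> t i" "0 \<le> h" "j \<in> {1..m}"
  shows "increment N t h j \<in> borel_measurable M"
proof -
  have "0 \<le> t j" "0 \<le> t (j - 1)" using assms by auto
  then show ?thesis
    unfolding increment_def[abs_def] using \<open>0 \<le> h\<close>
    by (intro measurable_ext_diff measurable_N) auto
qed

lemma measurable_increment_vector:
  assumes "\<And>i. i \<le> m \<Longrightarrow> 0 \<le> t i" "0 \<le> h"
  shows "increment_vector N m t h \<in> M \<rightarrow>\<^sub>M (\<Pi>\<^sub>M j\<in>{1..m}. borel)"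
  unfolding increment_vector_def[abs_def]
  using measurable_increment[where m=m and t=t and h=h] assms by (intro measurable_restrict) auto

lemma increment_values:
  assumes "\<And>i. i \<le> m \<Longrightarrow> 0 \<le> t i" "0 \<le> h" "j \<in> {1..m}" "\<omega> \<in> space M"
  shows "increment N t h j \<omega> \<in> count_values"
proof -
  have "0 \<le> t j" "0 \<le> t (j - 1)" using assms by auto
  then show ?thesis
    unfolding increment_def using assms by (intro ext_diff_count_values N_values) auto
qed

lemma increment_sets:
  assumes "\<And>i. i \<le> m \<Longrightarrow> 0 \<le> t i" "0 \<le> h" "j \<in> {1..m}"
  shows "{\<omega>\<in>space M. increment N t h j \<omega> = x} \<in> sets M"
  using measurable_sets[OF measurable_increment[where m=m and t=t and h=h and j=j, OF assms], of "{x}"]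
  by (simp add: vimage_def Int_def conj_commute)

lemma increments_sets:
  assumes "\<And>i. i \<le> m \<Longrightarrow> 0 \<le> t i" "0 \<le> h"
  shows "{\<omega>\<in>space M. \<forall>j\<in>{1..m}. increment N t h j \<omega> = c j} \<in> sets M"
  using increment_sets[where m=m and t=t and h=h] assms by (intro sets.sets_Collect_finite_All) auto

text \<open>Right-continuity of an integer-valued path means right-continuity for the discrete topology.\<close>

lemma N_eventually_eq:
  assumes \<omega>: "\<omega> \<in> space M" and s: "0 \<le> s" "\<And>n. s \<le> u n" "u \<longlonglongrightarrow> s"
  shows "eventually (\<lambda>n. N (u n) \<omega> = N s \<omega>) sequentially"
proof -
  have mono: "N s \<omega> \<le> N r \<omega>" if "s \<le> r" for r
    using counting \<omega> s(1) that by (auto simp: counting_process_def mono_on_def)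
  show ?thesis
  proof (cases "N s \<omega> = \<infinity>")
    case True
    then have "N (u n) \<omega> = N s \<omega>" for n using mono[OF s(2)[of n]] by (simp add: top_unique)
    then show ?thesis by simp
  next
    case False
    then obtain k where k: "N s \<omega> = of_nat k"
      using N_values[OF s(1) \<omega>] by (auto simp: count_values_def)
    have "continuous (at_right s) (\<lambda>r. N r \<omega>)"
      using counting \<omega> s(1) by (auto simp: counting_process_def)
    then have "((\<lambda>r. N r \<omega>) \<longlongrightarrow> N s \<omega>) (at_right s)"
      by (simp add: continuous_within)
    \<comment> \<open>Near \<open>s\<close> on the right the path stays below \<open>k + 1\<close>;
      being integer-valued and at least \<open>k\<close> by monotonicity, it equals
      \<open>k\<close>.\<close>
    moreover have "N s \<omega> < of_nat (Suc k)" by (simp add: k del: of_nat_Suc)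
    ultimately have "eventually (\<lambda>r. N r \<omega> < of_nat (Suc k)) (at_right s)"
      by (rule order_tendstoD)
    then obtain b where b: "s < b" "\<And>r. s < r \<Longrightarrow> r < b \<Longrightarrow> N r \<omega> < of_nat (Suc k)"
      by (auto simp: eventually_at_right_field)
    have "eventually (\<lambda>n. u n < b) sequentially"
      using s(3) b(1) by (rule order_tendstoD)
    then show ?thesis
    proof eventually_elim
      case (elim n)
      show ?case
      \<comment> \<open>The right neighbourhood filter says nothing about \<open>s\<close> itself,
        so a sequence that hits its limit is treated separately.\<close>
      proof (cases "u n = s")
        case False
        then have "s < u n" using s(2)[of n] by simp
        then have less: "N (u n) \<omega> < of_nat (Suc k)" using b elim by blast
        then obtain l where l: "N (u n) \<omega> = of_nat l"
          using N_values[of "u n" \<omega>] \<omega> s(1) \<open>s < u n\<close> by (auto simp: count_values_def)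
        then have "l < Suc k" "k \<le> l" using less mono[of "u n"] \<open>s < u n\<close> k
          by (simp_all only: of_nat_less_iff of_nat_le_iff less_imp_le)
        then show ?thesis using k l by simp
      qed simp
    qed
  qed
qed

end

text \<open>Rational approximation from above; it fixes \<open>0\<close>, so that approximating grids still start at \<open>0\<close>.\<close>

definition upper_grid :: "nat \<Rightarrow> real \<Rightarrow> real" where
  "upper_grid n x = of_int \<lceil>x * real (Suc n)\<rceil> / real (Suc n)"

lemma upper_grid_ge: "x \<le> upper_grid n x"
  unfolding upper_grid_def by (subst pos_le_divide_eq) auto

lemma upper_grid_le: "upper_grid n x \<le> x + 1 / real (Suc n)"
proof -
  have "upper_grid n x \<le> (x * real (Suc n) + 1) / real (Suc n)"
    unfolding upper_grid_def by (intro divide_right_mono of_int_ceiling_le_add_one) simp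
  also have "\<dots> = x + 1 / real (Suc n)"
    by (simp add: add_divide_distrib del: of_nat_Suc)
  finally show ?thesis .
qed

lemma upper_grid_tendsto: "(\<lambda>n. upper_grid n x) \<longlonglongrightarrow> x"
proof (rule tendsto_sandwich[where f="\<lambda>_. x" and h="\<lambda>n. x + 1 / real (Suc n)"])
  show "(\<lambda>n. x + 1 / real (Suc n)) \<longlonglongrightarrow> x"
    using tendsto_add[OF tendsto_const LIMSEQ_Suc[OF lim_inverse_n']] by simp
qed (use upper_grid_ge upper_grid_le in \<open>auto intro!: always_eventually simp del: of_nat_Suc\<close>)

lemma upper_grid_0[simp]: "upper_grid n 0 = 0"
  by (simp add: upper_grid_def)

lemma upper_grid_Rats: "upper_grid n x \<in> \<rat>"
  by (simp add: upper_grid_def)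

lemma upper_grid_nonneg: "0 \<le> x \<Longrightarrow> 0 \<le> upper_grid n x"
  using upper_grid_ge[of x n] by simp

text \<open>Each rounded point converges to \<open>t j\<close>, which lies strictly below
  \<open>t (Suc j)\<close> and hence below its rounding for large \<open>n\<close>. Only finitely
  many gaps have to be preserved.\<close>

lemma eventually_time_grid_upper_grid:
  assumes "time_grid m t"
  shows "eventually (\<lambda>n. time_grid m (\<lambda>j. upper_grid n (t j))) sequentially"
proof -
  have "eventually (\<lambda>n. upper_grid n (t j) < upper_grid n (t (Suc j))) sequentially" if "j < m" for j
  proof -
    have "t j < t (Suc j)" using assms that by (simp add: time_grid_def)
    from order_tendstoD(2)[OF upper_grid_tendsto this] show ?thesis
      by eventually_elim (use upper_grid_ge in \<open>blast intro: less_le_trans\<close>)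
  qed
  then have "eventually (\<lambda>n. \<forall>j\<in>{..<m}. upper_grid n (t j) < upper_grid n (t (Suc j))) sequentially"
    by (intro eventually_ball_finite) auto
  then show ?thesis
    by eventually_elim (use assms in \<open>auto simp: time_grid_def\<close>)
qed

text \<open>Grid point and shift are rounded up separately; their sum still tends to
  \<open>t i + h\<close> from above, so both endpoints of the increment are eventually
  exact.\<close>

lemma (in counting) increment_eventually_eq:
  assumes "\<omega> \<in> space M" "\<And>i. i \<le> m \<Longrightarrow> 0 \<le> t i" "0 \<le> h" "j \<in> {1..m}"
  shows "eventually (\<lambda>n. increment N (\<lambda>i. upper_grid n (t i)) (upper_grid n h) j \<omega> = increment N t h j \<omega>)
    sequentially"
proof -
  have *: "eventually (\<lambda>n. N (upper_grid n (t i) + upper_grid n h) \<omega> = N (t i + h) \<omega>) sequentially"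
    if "i \<le> m" for i
    using assms that
    by (intro N_eventually_eq) (auto intro!: add_mono upper_grid_ge tendsto_add upper_grid_tendsto)
  have "j \<le> m" "j - 1 \<le> m" using assms by auto
  from *[OF this(1)] *[OF this(2)] show ?thesis
    by eventually_elim (simp add: increment_def)
qed

text \<open>Restricting the rounded grid to \<open>{..m}\<close> puts it into the countable set of
  extensional rational vectors, on which \<open>R\<close> is available. \<open>cong\<close> then
  drops the restriction, as \<open>R\<close> looks at the points up to \<open>m\<close>
  only.\<close>

lemma eventually_rational_grid:
  assumes grid: "time_grid m t"
    and R: "\<And>s. s \<in> {..m} \<rightarrow>\<^sub>E \<rat> \<Longrightarrow> time_grid m s \<Longrightarrow> R s"
    and cong: "\<And>s s'. (\<And>i. i \<le> m \<Longrightarrow> s i = s' i) \<Longrightarrow> R s \<Longrightarrow> R s'"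
  shows "eventually (\<lambda>n. R (\<lambda>i. upper_grid n (t i))) sequentially"
  using eventually_time_grid_upper_grid[OF grid]
proof eventually_elim
  case (elim n)
  let ?s = "restrict (\<lambda>i. upper_grid n (t i)) {..m}"
  have "R ?s" using elim by (intro R) (auto simp: time_grid_def upper_grid_Rats)
  then show ?case by (rule cong[rotated]) simp
qed

lemma increment_cong:
  assumes "\<And>i. i \<le> m \<Longrightarrow> s i = s' i" "j \<in> {1..m}"
  shows "increment N s h j = increment N s' h j"
  using assms by (auto simp: increment_def fun_eq_iff)

subsection \<open>Reduction to rational time grids\<close>

locale counting_prob = counting M N + prob_space M for M :: "'a measure" and N
begin

lemma prob_increments_tendsto:
  assumes t: "\<And>i. i \<le> m \<Longrightarrow> 0 \<le> t i" and h: "0 \<le> h"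
  shows "(\<lambda>n. prob {\<omega>\<in>space M. \<forall>j\<in>{1..m}.
      increment N (\<lambda>i. upper_grid n (t i)) (upper_grid n h) j \<omega> = c j})
    \<longlonglongrightarrow> prob {\<omega>\<in>space M. \<forall>j\<in>{1..m}. increment N t h j \<omega> = c j}"
proof (rule prob_tendsto_eventually)
  fix \<omega> assume \<omega>: "\<omega> \<in> space M"
  have "eventually (\<lambda>n. \<forall>j\<in>{1..m}.
      increment N (\<lambda>i. upper_grid n (t i)) (upper_grid n h) j \<omega> = increment N t h j \<omega>) sequentially"
    using increment_eventually_eq[OF \<omega>, of m t h] t h by (intro eventually_ball_finite) auto
  then show "eventually (\<lambda>n.
      \<omega> \<in> {\<omega>\<in>space M. \<forall>j\<in>{1..m}. increment N (\<lambda>i. upper_grid n (t i)) (upper_grid n h) j \<omega> = c j} \<longleftrightarrow>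
      \<omega> \<in> {\<omega>\<in>space M. \<forall>j\<in>{1..m}. increment N t h j \<omega> = c j}) sequentially"
    by eventually_elim auto
qed (use t h in \<open>auto intro!: increments_sets upper_grid_nonneg simp del: One_nat_def\<close>)

lemma prob_increment_tendsto:
  assumes t: "\<And>i. i \<le> m \<Longrightarrow> 0 \<le> t i" and h: "0 \<le> h" and j: "j \<in> {1..m}"
  shows "(\<lambda>n. prob {\<omega>\<in>space M. increment N (\<lambda>i. upper_grid n (t i)) (upper_grid n h) j \<omega> = x})
    \<longlonglongrightarrow> prob {\<omega>\<in>space M. increment N t h j \<omega> = x}"
proof (rule prob_tendsto_eventually)
  fix \<omega> assume \<omega>: "\<omega> \<in> space M"
  show "eventually (\<lambda>n.
      \<omega> \<in> {\<omega>\<in>space M. increment N (\<lambda>i. upper_grid n (t i)) (upper_grid n h) j \<omega> = x} \<longleftrightarrow>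
      \<omega> \<in> {\<omega>\<in>space M. increment N t h j \<omega> = x}) sequentially"
    using increment_eventually_eq[where m=m and t=t and h=h and j=j, OF \<omega>] t h j
    by (auto elim!: eventually_mono)
qed (use t h j in \<open>auto intro!: increment_sets[of m] upper_grid_nonneg\<close>)

text \<open>Both sides of the product formula converge along rounded grids, so the formula passes to
  real grids by uniqueness of limits.\<close>

lemma independent_incrementsI_rational:
  assumes *: "\<And>m t c. t \<in> {..m} \<rightarrow>\<^sub>E \<rat> \<Longrightarrow> time_grid m t \<Longrightarrow> c \<in> {1..m} \<rightarrow>\<^sub>E count_values \<Longrightarrow>
    prob {\<omega>\<in>space M. \<forall>j\<in>{1..m}. increment N t 0 j \<omega> = c j} =
    (\<Prod>j\<in>{1..m}. prob {\<omega>\<in>space M. increment N t 0 j \<omega> = c j})"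
  shows "independent_increments M N"
  unfolding independent_increments_def
proof (intro allI impI)
  fix m t assume grid: "time_grid m t"
  note t = time_grid_nonneg[OF grid]
  show "indep_vars (\<lambda>_. borel) (increment N t 0) {1..m}"
  proof (rule indep_vars_countableI)
    show "{1..m} \<noteq> {}" using grid by (auto simp: time_grid_def)
    show "random_variable borel (increment N t 0 i)" if "i \<in> {1..m}" for i
      using t that by (intro measurable_increment[of m]) auto
    show "increment N t 0 i \<omega> \<in> count_values" if "i \<in> {1..m}" "\<omega> \<in> space M" for i \<omega>
      using t that by (intro increment_values[of m]) auto
    fix c assume c: "c \<in> {1..m} \<rightarrow>\<^sub>E count_values"
    let ?R = "\<lambda>s. prob {\<omega>\<in>space M. \<forall>j\<in>{1..m}. increment N s 0 j \<omega> = c j} =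
      (\<Prod>j\<in>{1..m}. prob {\<omega>\<in>space M. increment N s 0 j \<omega> = c j})"
    \<comment> \<open>The formula is available only for large \<open>n\<close>, once the rounded
      points form a time grid.\<close>
    have "eventually (\<lambda>n. ?R (\<lambda>i. upper_grid n (t i))) sequentially"
    proof (rule eventually_rational_grid[OF grid])
      show "?R s" if "s \<in> {..m} \<rightarrow>\<^sub>E \<rat>" "time_grid m s" for s
        using that c by (rule *)
      show "?R s'" if "\<And>i. i \<le> m \<Longrightarrow> s i = s' i" "?R s" for s s'
        using that(2) by (simp add: increment_cong[of m s s', OF that(1)])
    qed
    \<comment> \<open>Rounding fixes the shift 0, so the general convergence result applies with no
      shift on either side.\<close>
    moreover have "(\<lambda>n. prob {\<omega>\<in>space M. \<forall>j\<in>{1..m}. increment N (\<lambda>i. upper_grid n (t i)) 0 j \<omega> = c j})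
        \<longlonglongrightarrow> prob {\<omega>\<in>space M. \<forall>j\<in>{1..m}. increment N t 0 j \<omega> = c j}"
      using prob_increments_tendsto[of m t 0 c] t by simp
    ultimately have "(\<lambda>n. \<Prod>j\<in>{1..m}. prob {\<omega>\<in>space M. increment N (\<lambda>i. upper_grid n (t i)) 0 j \<omega> = c j})
        \<longlonglongrightarrow> prob {\<omega>\<in>space M. \<forall>j\<in>{1..m}. increment N t 0 j \<omega> = c j}"
      by (rule Lim_transform_eventually[rotated])
    moreover have "(\<lambda>n. \<Prod>j\<in>{1..m}. prob {\<omega>\<in>space M. increment N (\<lambda>i. upper_grid n (t i)) 0 j \<omega> = c j})
        \<longlonglongrightarrow> (\<Prod>j\<in>{1..m}. prob {\<omega>\<in>space M. increment N t 0 j \<omega> = c j})"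
      using prob_increment_tendsto[of m t 0] t by (intro tendsto_prod) simp
    ultimately show "?R t"
      by (rule LIMSEQ_unique)
  qed (auto simp: countable_count_values)
qed

lemma stationary_incrementsI_rational:
  assumes *: "\<And>m t h c. t \<in> {..m} \<rightarrow>\<^sub>E \<rat> \<Longrightarrow> time_grid m t \<Longrightarrow> h \<in> \<rat> \<Longrightarrow> 0 \<le> h \<Longrightarrow>
    c \<in> {1..m} \<rightarrow>\<^sub>E count_values \<Longrightarrow>
    prob {\<omega>\<in>space M. \<forall>j\<in>{1..m}. increment N t h j \<omega> = c j} =
    prob {\<omega>\<in>space M. \<forall>j\<in>{1..m}. increment N t 0 j \<omega> = c j}"
  shows "stationary_increments M N"
  unfolding stationary_increments_def increment_vector_def[abs_def]
proof (intro allI impI)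
  fix m t and h :: real assume grid: "time_grid m t" and h: "0 \<le> h"
  note t = time_grid_nonneg[OF grid]
  show "distr M (\<Pi>\<^sub>M j\<in>{1..m}. borel) (\<lambda>\<omega>. \<lambda>j\<in>{1..m}. increment N t h j \<omega>) =
    distr M (\<Pi>\<^sub>M j\<in>{1..m}. borel) (\<lambda>\<omega>. \<lambda>j\<in>{1..m}. increment N t 0 j \<omega>)"
  proof (rule distr_PiM_eq_countableI)
    show "random_variable borel (increment N t h i)" "random_variable borel (increment N t 0 i)"
      if "i \<in> {1..m}" for i
      using t h that by (auto intro!: measurable_increment[of m])
    show "increment N t h i \<omega> \<in> count_values" if "i \<in> {1..m}" "\<omega> \<in> space M" for i \<omega>
      using t h that by (intro increment_values[of m]) auto
    fix c assume c: "c \<in> {1..m} \<rightarrow>\<^sub>E count_values"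
    let ?p = "\<lambda>s h. prob {\<omega>\<in>space M. \<forall>j\<in>{1..m}. increment N s h j \<omega> = c j}"
    \<comment> \<open>The quantifier over all rational shifts stays inside, because the shift
      \<open>upper_grid n h\<close> inserted next changes with \<open>n\<close>.\<close>
    have "eventually (\<lambda>n. \<forall>r\<in>\<rat> \<inter> {0..}. ?p (\<lambda>i. upper_grid n (t i)) r = ?p (\<lambda>i. upper_grid n (t i)) 0) sequentially"
    proof (rule eventually_rational_grid[OF grid])
      show "\<forall>r\<in>\<rat> \<inter> {0..}. ?p s r = ?p s 0" if "s \<in> {..m} \<rightarrow>\<^sub>E \<rat>" "time_grid m s" for s
        using *[OF that _ _ c] by blast
      show "\<forall>r\<in>\<rat> \<inter> {0..}. ?p s' r = ?p s' 0"
        if "\<And>i. i \<le> m \<Longrightarrow> s i = s' i" "\<forall>r\<in>\<rat> \<inter> {0..}. ?p s r = ?p s 0" for s s'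
      proof
        fix r :: real assume r: "r \<in> \<rat> \<inter> {0..}"
        have *: "?p s' r = ?p s r" for r :: real
          by (intro arg_cong[where f=prob] Collect_cong conj_cong refl ball_cong)
            (simp add: increment_cong[of m s s', OF that(1)])
        show "?p s' r = ?p s' 0"
          unfolding * using that(2) r by (rule bspec)
      qed
    qed
    then have "eventually (\<lambda>n. ?p (\<lambda>i. upper_grid n (t i)) (upper_grid n h) = ?p (\<lambda>i. upper_grid n (t i)) 0) sequentially"
    proof eventually_elim
      case (elim n)
      have "upper_grid n h \<in> \<rat> \<inter> {0..}" using h by (simp add: upper_grid_Rats upper_grid_nonneg)
      with elim show ?case by (rule bspec)
    qed
    moreover have "(\<lambda>n. ?p (\<lambda>i. upper_grid n (t i)) (upper_grid n h)) \<longlonglongrightarrow> ?p t h"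
      using t h by (rule prob_increments_tendsto)
    ultimately have "(\<lambda>n. ?p (\<lambda>i. upper_grid n (t i)) 0) \<longlonglongrightarrow> ?p t h"
      by (rule Lim_transform_eventually[rotated])
    moreover have "(\<lambda>n. ?p (\<lambda>i. upper_grid n (t i)) 0) \<longlonglongrightarrow> ?p t 0"
      using prob_increments_tendsto[of m t 0 c] t by simp
    ultimately show "?p t h = ?p t 0" by (rule LIMSEQ_unique)
  qed (auto simp: countable_count_values)
qed

text \<open>At a singleton, the law of the process converges along rational times from above by
  right-continuity of the paths, and \<open>K\<close> converges by its continuity in time.\<close>

lemma distr_N_eqI_rational:
  assumes K: "\<And>t. 0 \<le> t \<Longrightarrow> K t \<in> space (prob_algebra borel)"
    and cont: "\<And>B. B \<in> sets borel \<Longrightarrow> continuous_on {0..} (\<lambda>t. measure (K t) B)"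
    and eq: "\<And>t x. t \<in> \<rat> \<Longrightarrow> 0 \<le> t \<Longrightarrow> x \<in> count_values \<Longrightarrow>
      prob {\<omega>\<in>space M. N t \<omega> = x} = measure (K t) {x}"
    and t: "0 \<le> t"
  shows "distr M borel (N t) = K t"
proof (rule prob_measure_eqI_countable[OF _ _ _ countable_count_values])
  note N = measurable_N[OF t]
  show "prob_space (distr M borel (N t))" by (rule prob_space_distr) fact
  show "prob_space (K t)" "sets (distr M borel (N t)) = sets (K t)"
    using K[OF t] by (auto simp: space_prob_algebra)
  have "count_values \<in> sets borel"
    using countable_count_values by (rule sets.countable[rotated]) auto
  then show "AE x in distr M borel (N t). x \<in> count_values"
    using N_values[OF t] N by (subst AE_distr_iff) auto
  fix x assume x: "x \<in> count_values"
  have N_sets: "{\<omega>\<in>space M. N s \<omega> = x} \<in> events" if "0 \<le> s" for s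
    using measurable_sets[OF measurable_N[OF that], of "{x}"]
    by (simp add: vimage_def Int_def conj_commute)
  have "(\<lambda>n. prob {\<omega>\<in>space M. N (upper_grid n t) \<omega> = x}) \<longlonglongrightarrow> prob {\<omega>\<in>space M. N t \<omega> = x}"
  proof (rule prob_tendsto_eventually)
    fix \<omega> assume \<omega>: "\<omega> \<in> space M"
    have "eventually (\<lambda>n. N (upper_grid n t) \<omega> = N t \<omega>) sequentially"
      using \<omega> t upper_grid_ge upper_grid_tendsto by (rule N_eventually_eq)
    then show "eventually (\<lambda>n. \<omega> \<in> {\<omega>\<in>space M. N (upper_grid n t) \<omega> = x} \<longleftrightarrow>
        \<omega> \<in> {\<omega>\<in>space M. N t \<omega> = x}) sequentially"
      by eventually_elim auto
  qed (use t in \<open>auto intro!: N_sets upper_grid_nonneg\<close>)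
  then have "(\<lambda>n. measure (K (upper_grid n t)) {x}) \<longlonglongrightarrow> prob {\<omega>\<in>space M. N t \<omega> = x}"
    using t x by (simp add: eq upper_grid_Rats upper_grid_nonneg)
  moreover have "(\<lambda>n. measure (K (upper_grid n t)) {x}) \<longlonglongrightarrow> measure (K t) {x}"
    using cont[of "{x}"] upper_grid_tendsto[of t]
    by (rule continuous_on_tendsto_compose) (use t in \<open>auto simp: upper_grid_nonneg\<close>)
  ultimately have "prob {\<omega>\<in>space M. N t \<omega> = x} = measure (K t) {x}"
    by (rule LIMSEQ_unique)
  then show "measure (distr M borel (N t)) {x} = measure (K t) {x}"
    using N by (simp add: measure_distr vimage_def Int_def conj_commute)
qed simp

end

subsection \<open>Conditioning through the disintegration\<close>

lemma kernels_eq_AE_refl: "kernels_eq_AE P F M' k k"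
  by (simp add: kernels_eq_AE_def)

locale disintegrated_counting = counting_prob P N for P :: "'a measure" and N +
  fixes Z :: "'b measure" and \<Theta> :: "'a \<Rightarrow> 'b" and Q :: "'b \<Rightarrow> 'a measure"
  assumes \<Theta>[measurable]: "\<Theta> \<in> P \<rightarrow>\<^sub>M Z"
    and disintegration: "disintegration P Z \<Theta> Q"
begin

abbreviation F :: "'a measure" where "F \<equiv> sigma_gen P Z \<Theta>"

lemma Q_measurable: "Q \<in> Z \<rightarrow>\<^sub>M prob_algebra P"
  using disintegration by (simp add: disintegration_def)

lemma Q_prob_space: "\<theta> \<in> space Z \<Longrightarrow> prob_space (Q \<theta>)"
  and sets_Q: "\<theta> \<in> space Z \<Longrightarrow> sets (Q \<theta>) = sets P"
  using measurable_space[OF Q_measurable] by (auto simp: space_prob_algebra)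

lemma space_Q: "\<theta> \<in> space Z \<Longrightarrow> space (Q \<theta>) = space P"
  using sets_Q by (rule sets_eq_imp_space_eq)

text \<open>The path properties hold at every point of the space, with no exceptional set, so
  changing the measure on the same measurable space preserves them.\<close>

lemma counting_prob_Q:
  assumes "\<theta> \<in> space Z"
  shows "counting_prob (Q \<theta>) N"
proof (intro counting_prob.intro counting.intro)
  have "borel_measurable (Q \<theta>) = (borel_measurable P :: ('a \<Rightarrow> ennreal) set)"
    using sets_Q[OF assms] by (rule measurable_cong_sets) simp
  then show "counting_process (Q \<theta>) N"
    using counting space_Q[OF assms] by (simp add: counting_process_def)
  show "prob_space (Q \<theta>)" using assms by (rule Q_prob_space)
qed

lemma measurable_measure_Q:
  "D \<in> sets P \<Longrightarrow> (\<lambda>\<theta>. measure (Q \<theta>) D) \<in> borel_measurable Z"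
  using measurable_measure_prob_algebra Q_measurable by (rule measurable_compose[rotated])

lemma integral_measure_Q:
  assumes D: "D \<in> sets P"
  shows "(\<integral>\<theta>. measure (Q \<theta>) D \<partial>distr P Z \<Theta>) = prob D"
proof -
  have "(\<integral>\<theta>. measure (Q \<theta>) D \<partial>distr P Z \<Theta>) = enn2real (\<integral>\<^sup>+\<theta>. ennreal (measure (Q \<theta>) D) \<partial>distr P Z \<Theta>)"
    using measurable_measure_Q[OF D] by (intro integral_eq_nn_integral) auto
  also have "(\<integral>\<^sup>+\<theta>. ennreal (measure (Q \<theta>) D) \<partial>distr P Z \<Theta>) = (\<integral>\<^sup>+\<theta>. emeasure (Q \<theta>) D \<partial>distr P Z \<Theta>)"
  proof (rule nn_integral_cong)
    fix \<theta> assume "\<theta> \<in> space (distr P Z \<Theta>)"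
    then interpret Q: prob_space "Q \<theta>" by (intro Q_prob_space) simp
    show "ennreal (measure (Q \<theta>) D) = emeasure (Q \<theta>) D"
      by (simp add: Q.emeasure_eq_measure)
  qed
  also have "\<dots> = emeasure P D"
    using disintegration D by (simp add: disintegration_def)
  finally show ?thesis by (simp add: measure_def)
qed

text \<open>Consistency is applied to \<open>B\<close> and to its complement: almost every
  \<open>Q \<theta>\<close> is concentrated on the preimage of whichever of the two sets contains
  \<open>\<theta>\<close>.\<close>

lemma AE_Q_fibre:
  assumes B: "B \<in> sets Z" and D: "D \<in> sets P"
  shows "AE \<theta> in distr P Z \<Theta>.
    indicator B \<theta> * measure (Q \<theta>) D = measure (Q \<theta>) (\<Theta> -` B \<inter> space P \<inter> D)"
proof -
  let ?A = "\<Theta> -` B \<inter> space P"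
  let ?A' = "\<Theta> -` (space Z - B) \<inter> space P"
  have A: "?A \<in> sets P" "?A' \<in> sets P" using B by auto
  have fibre: "AE \<theta> in distr P Z \<Theta>. \<theta> \<in> B \<longrightarrow> emeasure (Q \<theta>) (\<Theta> -` B \<inter> space P) = 1"
    if "B \<in> sets Z" for B
    using disintegration that by (simp add: disintegration_def)
  have "space Z - B \<in> sets Z" using B by blast
  from fibre[OF B] fibre[OF this] AE_space show ?thesis
  proof eventually_elim
    case (elim \<theta>)
    then have \<theta>: "\<theta> \<in> space Z" by simp
    interpret Q: prob_space "Q \<theta>" using \<theta> by (rule Q_prob_space)
    note [simp] = sets_Q[OF \<theta>]
    show ?case
    proof (cases "\<theta> \<in> B")
      case True
      then have "AE \<omega> in Q \<theta>. \<omega> \<in> ?A"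
        using elim A by (subst Q.AE_in_set_eq_1) (auto simp: Q.emeasure_eq_measure)
      then have "measure (Q \<theta>) D = measure (Q \<theta>) (?A \<inter> D)"
        using A D by (intro Q.finite_measure_eq_AE) auto
      then show ?thesis using True by simp
    next
      case False
      then have "AE \<omega> in Q \<theta>. \<omega> \<in> ?A'"
        using elim \<theta> A by (subst Q.AE_in_set_eq_1) (auto simp: Q.emeasure_eq_measure)
      \<comment> \<open>Here \<open>Q \<theta>\<close> lives on the preimage of the complement, so
        \<open>?A \<inter> D\<close> agrees almost surely with the empty set.\<close>
      then have "measure (Q \<theta>) {} = measure (Q \<theta>) (?A \<inter> D)"
        using A D by (intro Q.finite_measure_eq_AE) auto
      then show ?thesis using False by simp
    qed
  qed
qed

section \<open>Conditional probabilities and distributions expressed through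
  \<open>Q\<close>\<close>

lemma sets_F: "sets F = {\<Theta> -` B \<inter> space P | B. B \<in> sets Z}"
  unfolding sigma_gen_def using measurable_space[OF \<Theta>] by (intro sets_vimage_algebra2) auto

lemma subalgebra_F: "subalgebra P F"
  unfolding subalgebra_def using sets_F by (auto simp: sigma_gen_def)

lemma measurable_F: "\<Theta> \<in> F \<rightarrow>\<^sub>M Z"
  unfolding sigma_gen_def using measurable_space[OF \<Theta>] by (intro measurable_vimage_algebra1) auto

text \<open>The averaging property is checked on a set \<open>A\<close> that is the preimage of some
  \<open>B\<close>: transport the integral to \<open>Z\<close>, absorb the indicator of
  \<open>B\<close> by the fibre identity, and integrate \<open>Q\<close> back to \<open>P\<close>.
  The null set depends on \<open>D\<close>, whence the later reductions to countably many
  events.\<close>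

lemma cond_probability_eq:
  assumes D[measurable]: "D \<in> sets P"
  shows "AE \<omega> in P. cond_probability P F D \<omega> = measure (Q (\<Theta> \<omega>)) D"
proof -
  interpret finite_measure_subalgebra P F
    by standard (rule subalgebra_F)
  note [measurable] = measurable_measure_Q
  show ?thesis
    unfolding cond_probability_def
  proof (rule real_cond_exp_charact)
    fix A assume "A \<in> sets F"
    then obtain B where B[measurable]: "B \<in> sets Z" and A: "A = \<Theta> -` B \<inter> space P"
      by (auto simp: sets_F)
    have [measurable]: "A \<in> sets P" unfolding A by measurable
    have "(\<integral>\<omega>\<in>A. measure (Q (\<Theta> \<omega>)) D \<partial>P) = (\<integral>\<omega>. indicator B (\<Theta> \<omega>) * measure (Q (\<Theta> \<omega>)) D \<partial>P)"
      unfolding set_lebesgue_integral_def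
      by (intro Bochner_Integration.integral_cong) (auto simp: A indicator_def)
    also have "\<dots> = (\<integral>\<theta>. indicator B \<theta> * measure (Q \<theta>) D \<partial>distr P Z \<Theta>)"
      by (intro integral_distr[symmetric]) measurable
    also have "\<dots> = (\<integral>\<theta>. measure (Q \<theta>) (A \<inter> D) \<partial>distr P Z \<Theta>)"
      using AE_Q_fibre[OF B D] by (intro integral_cong_AE) (auto simp: A[symmetric])
    also have "\<dots> = prob (A \<inter> D)" by (rule integral_measure_Q) measurable
    also have "\<dots> = (\<integral>\<omega>\<in>A. indicator D \<omega> \<partial>P)"
      unfolding set_lebesgue_integral_def by (simp flip: indicator_inter_arith)
    finally show "(\<integral>\<omega>\<in>A. indicator D \<omega> \<partial>P) = (\<integral>\<omega>\<in>A. measure (Q (\<Theta> \<omega>)) D \<partial>P)" by simp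
  next
    show "integrable P (indicator D :: 'a \<Rightarrow> real)"
      by (intro integrable_real_indicator) (auto simp: less_top[symmetric])
    show "integrable P (\<lambda>\<omega>. measure (Q (\<Theta> \<omega>)) D)"
    proof (rule integrable_const_bound[where B=1])
      show "AE \<omega> in P. norm (measure (Q (\<Theta> \<omega>)) D) \<le> 1"
        using measurable_space[OF \<Theta>] Q_prob_space by (auto intro!: prob_space.prob_le_1)
    qed measurable
    show "(\<lambda>\<omega>. measure (Q (\<Theta> \<omega>)) D) \<in> borel_measurable F"
      using measurable_F measurable_measure_Q[OF D] by (rule measurable_compose)
  qed
qed

text \<open>\<open>\<Theta>\<close> has the same image law under \<open>P\<close> restricted to
  \<open>F\<close>, so the exceptional set can be found inside \<open>F\<close>, as almost sure
  equality of kernels demands.\<close>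

lemma AE_restr_F:
  assumes "AE \<theta> in distr P Z \<Theta>. R \<theta>"
  shows "AE \<omega> in restr_to_subalg P F. R (\<Theta> \<omega>)"
proof -
  have *: "\<Theta> \<in> restr_to_subalg P F \<rightarrow>\<^sub>M Z"
    using measurable_F by (simp add: measurable_cong_sets[OF sets_restr_to_subalg[OF subalgebra_F] refl])
  have "distr (restr_to_subalg P F) Z \<Theta> = distr P Z \<Theta>"
  proof (rule measure_eqI)
    fix B assume "B \<in> sets (distr (restr_to_subalg P F) Z \<Theta>)"
    then have B: "B \<in> sets Z" by simp
    then have "\<Theta> -` B \<inter> space P \<in> sets F" by (auto simp: sets_F)
    then show "emeasure (distr (restr_to_subalg P F) Z \<Theta>) B = emeasure (distr P Z \<Theta>) B"
      using B * by (simp add: emeasure_distr space_restr_to_subalg emeasure_restr_to_subalg[OF subalgebra_F])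
  qed simp
  then have "AE \<theta> in distr (restr_to_subalg P F) Z \<Theta>. R \<theta>" using assms by (simp only:)
  with * show ?thesis by (rule AE_distrD)
qed

text \<open>Going back from \<open>P\<close> to the image measure uses that the set where
  \<open>f\<close> and \<open>g\<close> agree is measurable.\<close>

lemma AE_Q_eq:
  assumes "f \<in> borel_measurable Z" "g \<in> borel_measurable Z"
    and "AE \<omega> in P. f (\<Theta> \<omega>) = (g (\<Theta> \<omega>) :: real)"
  shows "AE \<theta> in distr P Z \<Theta>. f \<theta> = g \<theta>"
  using assms by (subst AE_distr_iff) (auto simp: borel_measurable_eq)

text \<open>Measurability comes from composing \<open>\<Theta>\<close>, \<open>Q\<close> and the
  push-forward along \<open>X\<close>. This supplies explicit witnesses for the kernels that the
  conditional notions only assert to exist.\<close>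

lemma is_cond_distr_distr:
  assumes X: "X \<in> P \<rightarrow>\<^sub>M M'"
  shows "is_cond_distr P F M' X (\<lambda>\<omega>. distr (Q (\<Theta> \<omega>)) M' X)"
  unfolding is_cond_distr_def
proof (intro conjI ballI)
  show "(\<lambda>\<omega>. distr (Q (\<Theta> \<omega>)) M' X) \<in> F \<rightarrow>\<^sub>M prob_algebra M'"
    using measurable_compose[OF measurable_F Q_measurable] X by (rule measurable_compose[OF _ measurable_distr_prob_space])
  fix B assume B: "B \<in> sets M'"
  then have D: "X -` B \<inter> space P \<in> sets P" using X by (rule measurable_sets[rotated])
  show "AE \<omega> in P. measure (distr (Q (\<Theta> \<omega>)) M' X) B = cond_probability P F (X -` B \<inter> space P) \<omega>"
    using cond_probability_eq[OF D] AE_space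
  proof eventually_elim
    case (elim \<omega>)
    then have \<theta>: "\<Theta> \<omega> \<in> space Z" using measurable_space[OF \<Theta>] by simp
    have "X \<in> Q (\<Theta> \<omega>) \<rightarrow>\<^sub>M M'" using X measurable_cong_sets[OF sets_Q[OF \<theta>] refl] by blast
    then show ?case using elim B by (simp add: measure_distr space_Q[OF \<theta>])
  qed
qed

text \<open>For a fixed \<open>B\<close> the value of \<open>l\<close> equals that of
  \<open>k\<close>, hence the conditional probability, hence the value given by
  \<open>Q\<close>.\<close>

lemma cond_distr_AE_eq:
  assumes X: "X \<in> P \<rightarrow>\<^sub>M M'" and k: "is_cond_distr P F M' X k"
    and kl: "kernels_eq_AE P F M' k l" and B: "B \<in> sets M'"
  shows "AE \<omega> in P. measure (l \<omega>) B = measure (Q (\<Theta> \<omega>)) (X -` B \<inter> space P)"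
proof -
  have D: "X -` B \<inter> space P \<in> sets P" using B X by (rule measurable_sets[rotated])
  have "AE \<omega> in P. \<forall>B\<in>sets M'. measure (k \<omega>) B = measure (l \<omega>) B"
    using kl unfolding kernels_eq_AE_def by (rule AE_restr_to_subalg[OF subalgebra_F])
  moreover have "AE \<omega> in P. measure (k \<omega>) B = cond_probability P F (X -` B \<inter> space P) \<omega>"
    using k B by (simp add: is_cond_distr_def)
  ultimately show ?thesis using cond_probability_eq[OF D]
    by eventually_elim (use B in auto)
qed

section \<open>From conditional properties to properties under almost every
  \<open>Q \<theta>\<close>\<close>

lemma AE_independent_increments_Q:
  assumes ind: "cond_independent_increments P Z \<Theta> N"
  shows "AE \<theta> in distr P Z \<Theta>. independent_increments (Q \<theta>) N"
proof -
  let ?E = "\<lambda>t c j. {\<omega>\<in>space P. increment N t 0 j \<omega> = c j}"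
  let ?R = "\<lambda>\<theta> m t c. measure (Q \<theta>) {\<omega>\<in>space P. \<forall>j\<in>{1..m}. increment N t 0 j \<omega> = c j} =
    (\<Prod>j\<in>{1..m}. measure (Q \<theta>) (?E t c j))"
  have R: "AE \<theta> in distr P Z \<Theta>. ?R \<theta> m t c" if grid: "time_grid m t" for m t c
  \<comment> \<open>Conditional independence speaks of at least two events; for a single increment
    the product formula is trivial.\<close>
  proof (cases "m = 1")
    case False
    note t = time_grid_nonneg[OF grid]
    have m: "2 \<le> m" using grid False by (auto simp: time_grid_def)
    have E: "?E t c j \<in> sets P" if "j \<in> {1..m}" for j
      using t that by (intro increment_sets[of m]) auto
    have Int: "(\<Inter>j\<in>{1..m}. ?E t c j) = {\<omega>\<in>space P. \<forall>j\<in>{1..m}. increment N t 0 j \<omega> = c j}"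
    proof -
      \<comment> \<open>Since the index set is nonempty, the intersection stays inside
        \<open>space P\<close>.\<close>
      have "1 \<in> {1..m}" using m by simp
      then show ?thesis by blast
    qed
    have sets: "(\<Inter>j\<in>{1..m}. ?E t c j) \<in> sets P"
      unfolding Int using t by (intro increments_sets) auto
    have gen: "?E t c j \<in> sets (sigma_gen P borel (increment N t 0 j))" for j
    proof -
      have "?E t c j = increment N t 0 j -` {c j} \<inter> space P" by auto
      then show ?thesis unfolding sigma_gen_def by (simp add: in_vimage_algebra)
    qed
    have "AE \<omega> in P. cond_probability P F (\<Inter>j\<in>{1..m}. ?E t c j) \<omega> =
        (\<Prod>j\<in>{1..m}. cond_probability P F (?E t c j) \<omega>)"
    proof -
      have "cond_indep_vars P F (\<lambda>_. borel) (increment N t 0) {1..m}"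
        using ind grid by (simp add: cond_independent_increments_def)
      then show ?thesis
        unfolding cond_indep_vars_def using gen m
        by (elim conjE allE[of _ "{1..m}"] allE[of _ "?E t c"]) simp
    qed
    moreover have "AE \<omega> in P. \<forall>j\<in>{1..m}. cond_probability P F (?E t c j) \<omega> = measure (Q (\<Theta> \<omega>)) (?E t c j)"
      using cond_probability_eq[OF E] by (intro AE_finite_allI) auto
    ultimately have "AE \<omega> in P. measure (Q (\<Theta> \<omega>)) (\<Inter>j\<in>{1..m}. ?E t c j) =
        (\<Prod>j\<in>{1..m}. measure (Q (\<Theta> \<omega>)) (?E t c j))"
      using cond_probability_eq[OF sets] by eventually_elim simp
    then have "AE \<theta> in distr P Z \<Theta>. measure (Q \<theta>) (\<Inter>j\<in>{1..m}. ?E t c j) =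
        (\<Prod>j\<in>{1..m}. measure (Q \<theta>) (?E t c j))"
      using sets E by (intro AE_Q_eq borel_measurable_prod measurable_measure_Q) auto
    then show ?thesis unfolding Int .
  qed simp
  \<comment> \<open>Rational grids and value vectors are extensional functions on finite sets, hence
    countable in number, and one null set serves them all.\<close>
  have "AE \<theta> in distr P Z \<Theta>. \<forall>m. \<forall>t\<in>{..m} \<rightarrow>\<^sub>E \<rat>. \<forall>c\<in>{1..m} \<rightarrow>\<^sub>E count_values. time_grid m t \<longrightarrow> ?R \<theta> m t c"
    unfolding AE_all_countable
  proof
    fix m :: nat
    have "countable ({..m} \<rightarrow>\<^sub>E (\<rat> :: real set))" "countable ({1..m} \<rightarrow>\<^sub>E count_values)"
      by (auto intro!: countable_PiE countable_rat countable_count_values)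
    then show "AE \<theta> in distr P Z \<Theta>. \<forall>t\<in>{..m} \<rightarrow>\<^sub>E \<rat>. \<forall>c\<in>{1..m} \<rightarrow>\<^sub>E count_values. time_grid m t \<longrightarrow> ?R \<theta> m t c"
      using R by (simp add: AE_ball_countable)
  qed
  then show ?thesis using AE_space
  proof eventually_elim
    case (elim \<theta>)
    then have \<theta>: "\<theta> \<in> space Z" by simp
    then interpret Q: counting_prob "Q \<theta>" N by (rule counting_prob_Q)
    show ?case
    proof (rule Q.independent_incrementsI_rational, unfold space_Q[OF \<theta>])
      fix m t c assume "t \<in> {..m} \<rightarrow>\<^sub>E \<rat>" "time_grid m t" "c \<in> {1..m} \<rightarrow>\<^sub>E count_values"
      then show "?R \<theta> m t c" using elim(1) by blast
    qed
  qed
qed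

lemma AE_stationary_increments_Q:
  assumes stat: "cond_stationary_increments P Z \<Theta> N"
  shows "AE \<theta> in distr P Z \<Theta>. stationary_increments (Q \<theta>) N"
proof -
  let ?E = "\<lambda>m t h c. {\<omega>\<in>space P. \<forall>j\<in>{1..m}. increment N t h j \<omega> = c j}"
  have R: "AE \<theta> in distr P Z \<Theta>. measure (Q \<theta>) (?E m t h c) = measure (Q \<theta>) (?E m t 0 c)"
    if grid: "time_grid m t" and h: "0 \<le> h" and c: "c \<in> {1..m} \<rightarrow>\<^sub>E count_values" for m t h c
  proof -
    let ?B = "\<Pi>\<^sub>M j\<in>{1..m}. (borel :: ennreal measure)"
    note t = time_grid_nonneg[OF grid]
    have X: "increment_vector N m t h \<in> P \<rightarrow>\<^sub>M ?B" if "0 \<le> h" for h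
      using t that by (rule measurable_increment_vector)
    have vim: "increment_vector N m t h -` {c} \<inter> space P = ?E m t h c" for h
      using c by (auto simp: increment_vector_def PiE_iff extensional_def fun_eq_iff restrict_def)
    have B: "{c} \<in> sets ?B" using c by (intro PiM_borel_singleton) (auto simp: PiE_def)
    obtain k l where k: "is_cond_distr P F ?B (increment_vector N m t h) k"
      and l: "is_cond_distr P F ?B (increment_vector N m t 0) l" and kl: "kernels_eq_AE P F ?B k l"
      using stat grid h unfolding cond_stationary_increments_def by blast
    have "AE \<omega> in P. measure (Q (\<Theta> \<omega>)) (?E m t h c) = measure (Q (\<Theta> \<omega>)) (?E m t 0 c)"
      \<comment> \<open>Both probabilities are identified with the value of \<open>l\<close> at
        \<open>{c}\<close>: the shifted one through \<open>k\<close>, the unshifted one because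
        \<open>l\<close> is itself a conditional distribution.\<close>
      using cond_distr_AE_eq[OF X[OF h] k kl B] cond_distr_AE_eq[OF X[OF order.refl] l kernels_eq_AE_refl B]
      by eventually_elim (simp only: vim)
    moreover have "?E m t h c \<in> sets P" "?E m t 0 c \<in> sets P"
      using t h by (auto intro!: increments_sets simp del: One_nat_def)
    ultimately show ?thesis by (intro AE_Q_eq measurable_measure_Q)
  qed
  let ?R = "\<lambda>\<theta> m t h c. time_grid m t \<longrightarrow> measure (Q \<theta>) (?E m t h c) = measure (Q \<theta>) (?E m t 0 c)"
  have "AE \<theta> in distr P Z \<Theta>. \<forall>m. \<forall>t\<in>{..m} \<rightarrow>\<^sub>E \<rat>. \<forall>h\<in>\<rat> \<inter> {0..}. \<forall>c\<in>{1..m} \<rightarrow>\<^sub>E count_values. ?R \<theta> m t h c"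
    unfolding AE_all_countable
  proof
    fix m :: nat
    have count: "countable ({..m} \<rightarrow>\<^sub>E (\<rat> :: real set))" "countable (\<rat> \<inter> {0..} :: real set)"
      "countable ({1..m} \<rightarrow>\<^sub>E count_values)"
      by (auto intro!: countable_PiE countable_rat countable_count_values)
    show "AE \<theta> in distr P Z \<Theta>. \<forall>t\<in>{..m} \<rightarrow>\<^sub>E \<rat>. \<forall>h\<in>\<rat> \<inter> {0..}. \<forall>c\<in>{1..m} \<rightarrow>\<^sub>E count_values. ?R \<theta> m t h c"
      unfolding AE_ball_countable[OF count(1)] AE_ball_countable[OF count(2)] AE_ball_countable[OF count(3)]
      using R by auto
  qed
  then show ?thesis using AE_space
  proof eventually_elim
    case (elim \<theta>)
    then have \<theta>: "\<theta> \<in> space Z" by simp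
    then interpret Q: counting_prob "Q \<theta>" N by (rule counting_prob_Q)
    show ?case
    proof (rule Q.stationary_incrementsI_rational, unfold space_Q[OF \<theta>])
      fix m t and h :: real and c assume "t \<in> {..m} \<rightarrow>\<^sub>E \<rat>" "time_grid m t" "h \<in> \<rat>" "0 \<le> h"
        "c \<in> {1..m} \<rightarrow>\<^sub>E count_values"
      then show "measure (Q \<theta>) (?E m t h c) = measure (Q \<theta>) (?E m t 0 c)" using elim(1) by blast
    qed
  qed
qed

text \<open>One null set handles all rational times and all points of \<open>count_values\<close>.
  Outside it, continuity of \<open>K\<close> in time gives every real time, so the null set does not
  depend on \<open>t\<close>.\<close>

lemma AE_distr_Q:
  assumes K: "\<And>t. 0 \<le> t \<Longrightarrow> K t \<in> Z \<rightarrow>\<^sub>M prob_algebra borel"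
    and cont: "\<And>\<theta> B. \<theta> \<in> space Z \<Longrightarrow> B \<in> sets borel \<Longrightarrow> continuous_on {0..} (\<lambda>t. measure (K t \<theta>) B)"
    and cd: "\<And>t. 0 \<le> t \<Longrightarrow> \<exists>k. is_cond_distr P F borel (N t) k \<and>
      kernels_eq_AE P F borel k (\<lambda>\<omega>. K t (\<Theta> \<omega>))"
  shows "AE \<theta> in distr P Z \<Theta>. \<forall>t\<ge>0. distr (Q \<theta>) borel (N t) = K t \<theta>"
proof -
  let ?R = "\<lambda>\<theta> t x. measure (Q \<theta>) {\<omega>\<in>space P. N t \<omega> = x} = measure (K t \<theta>) {x}"
  have R: "AE \<theta> in distr P Z \<Theta>. ?R \<theta> t x" if t: "0 \<le> t" for t x
  proof -
    note N = measurable_N[OF t]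
    have vim: "N t -` {x} \<inter> space P = {\<omega>\<in>space P. N t \<omega> = x}" by auto
    obtain k where "is_cond_distr P F borel (N t) k" "kernels_eq_AE P F borel k (\<lambda>\<omega>. K t (\<Theta> \<omega>))"
      using cd[OF t] by blast
    from cond_distr_AE_eq[OF N this, of "{x}"]
    have "AE \<omega> in P. ?R (\<Theta> \<omega>) t x" by (auto simp: vim elim: eventually_mono)
    moreover have "{\<omega>\<in>space P. N t \<omega> = x} \<in> sets P"
      using measurable_sets[OF N, of "{x}"] by (simp add: vim)
    moreover have "(\<lambda>\<theta>. measure (K t \<theta>) {x}) \<in> borel_measurable Z"
      using K[OF t] by (rule measurable_compose) (simp add: measurable_measure_prob_algebra)
    ultimately show ?thesis by (intro AE_Q_eq measurable_measure_Q)
  qed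
  have "AE \<theta> in distr P Z \<Theta>. \<forall>t\<in>\<rat> \<inter> {0..}. \<forall>x\<in>count_values. ?R \<theta> t x"
    using R countable_count_values by (simp add: AE_ball_countable countable_rat)
  then show ?thesis using AE_space
  proof eventually_elim
    case (elim \<theta>)
    then have \<theta>: "\<theta> \<in> space Z" by simp
    then interpret Q: counting_prob "Q \<theta>" N by (rule counting_prob_Q)
    show ?case
    proof (intro allI impI)
      fix t :: real assume t: "0 \<le> t"
      show "distr (Q \<theta>) borel (N t) = K t \<theta>"
      proof (rule Q.distr_N_eqI_rational[where K="\<lambda>t. K t \<theta>"], unfold space_Q[OF \<theta>])
        show "K t \<theta> \<in> space (prob_algebra borel)" if "0 \<le> t" for t
          using K[OF that] \<theta> by (rule measurable_space)
        show "?R \<theta> t x" if "t \<in> \<rat>" "0 \<le> t" "x \<in> count_values" for t x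
          using elim(1) that by blast
      qed (use cont \<theta> t in auto)
    qed
  qed
qed

section \<open>From properties under almost every \<open>Q \<theta>\<close> to conditional
  properties\<close>

lemma cond_independent_incrementsI:
  assumes Q: "AE \<theta> in distr P Z \<Theta>. independent_increments (Q \<theta>) N"
  shows "cond_independent_increments P Z \<Theta> N"
  unfolding cond_independent_increments_def cond_indep_vars_def
proof (intro allI impI conjI ballI)
  fix m t assume grid: "time_grid m t"
  let ?X = "increment N t 0"
  show X: "?X j \<in> borel_measurable P" if "j \<in> {1..m}" for j
    using time_grid_nonneg[OF grid] that by (intro measurable_increment[of m]) auto
  fix J E assume J: "J \<subseteq> {1..m}" "finite J" "2 \<le> card J"
    and E: "\<forall>j\<in>J. E j \<in> sets (sigma_gen P borel (?X j))"
  \<comment> \<open>Events generated by an increment are preimages of Borel sets, the form in which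
    independence under \<open>Q (\<Theta> \<omega>)\<close> is applied.\<close>
  have "\<forall>j\<in>J. \<exists>B. B \<in> sets borel \<and> E j = ?X j -` B \<inter> space P"
    using E by (auto simp: sigma_gen_def sets_vimage_algebra2)
  then obtain B where B: "\<And>j. j \<in> J \<Longrightarrow> B j \<in> sets borel" "\<And>j. j \<in> J \<Longrightarrow> E j = ?X j -` B j \<inter> space P"
    by metis
  have "J \<noteq> {}" using J by auto
  have E: "E j \<in> sets P" if "j \<in> J" for j
    using B[OF that] X J that by (auto intro!: measurable_sets)
  then have sets: "(\<Inter>j\<in>J. E j) \<in> sets P"
    using J \<open>J \<noteq> {}\<close> by (intro sets.finite_INT)
  have "AE \<omega> in P. independent_increments (Q (\<Theta> \<omega>)) N"
    using \<Theta> Q by (rule AE_distrD)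
  moreover have "AE \<omega> in P. \<forall>j\<in>J. cond_probability P F (E j) \<omega> = measure (Q (\<Theta> \<omega>)) (E j)"
    using J cond_probability_eq[OF E] by (intro AE_finite_allI) auto
  ultimately show "AE \<omega> in P. cond_probability P F (\<Inter>j\<in>J. E j) \<omega> = (\<Prod>j\<in>J. cond_probability P F (E j) \<omega>)"
    using cond_probability_eq[OF sets] AE_space
  proof eventually_elim
    case (elim \<omega>)
    then have \<theta>: "\<Theta> \<omega> \<in> space Z" using measurable_space[OF \<Theta>] by blast
    interpret Q: prob_space "Q (\<Theta> \<omega>)" using \<theta> by (rule Q_prob_space)
    have "Q.indep_vars (\<lambda>_. borel) ?X {1..m}"
      using elim(1) grid by (simp add: independent_increments_def)
    from Q.indep_varsD[OF this \<open>J \<noteq> {}\<close> J(2,1), of B] B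
    have "measure (Q (\<Theta> \<omega>)) (\<Inter>j\<in>J. E j) = (\<Prod>j\<in>J. measure (Q (\<Theta> \<omega>)) (E j))"
      by (simp add: space_Q[OF \<theta>])
    then show ?case using elim by simp
  qed
qed

text \<open>The push-forwards of \<open>Q (\<Theta> \<omega>)\<close> serve as kernels. They
  coincide as measures outside a null set in \<open>F\<close>, which gives agreement on all
  measurable sets at once.\<close>

lemma cond_stationary_incrementsI:
  assumes Q: "AE \<theta> in distr P Z \<Theta>. stationary_increments (Q \<theta>) N"
  shows "cond_stationary_increments P Z \<Theta> N"
  unfolding cond_stationary_increments_def
proof (intro allI impI exI conjI)
  fix m t and h :: real assume grid: "time_grid m t" and h: "0 \<le> h"
  let ?B = "\<Pi>\<^sub>M j\<in>{1..m}. (borel :: ennreal measure)"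
  let ?k = "\<lambda>h \<omega>. distr (Q (\<Theta> \<omega>)) ?B (increment_vector N m t h)"
  show "is_cond_distr P F ?B (increment_vector N m t h) (?k h)"
    "is_cond_distr P F ?B (increment_vector N m t 0) (?k 0)"
    using time_grid_nonneg[OF grid] h
    by (auto intro!: is_cond_distr_distr measurable_increment_vector simp del: One_nat_def)
  have "AE \<omega> in restr_to_subalg P F. stationary_increments (Q (\<Theta> \<omega>)) N"
    using Q by (rule AE_restr_F)
  then show "kernels_eq_AE P F ?B (?k h) (?k 0)"
    unfolding kernels_eq_AE_def
  proof eventually_elim
    case (elim \<omega>)
    then have "?k h \<omega> = ?k 0 \<omega>" using grid h unfolding stationary_increments_def by blast
    then show ?case by simp
  qed
qed

lemma cond_distr_N:
  assumes t: "0 \<le> t" and Q: "AE \<theta> in distr P Z \<Theta>. distr (Q \<theta>) borel (N t) = K t \<theta>"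
  shows "\<exists>k. is_cond_distr P F borel (N t) k \<and> kernels_eq_AE P F borel k (\<lambda>\<omega>. K t (\<Theta> \<omega>))"
proof (intro exI conjI)
  show "is_cond_distr P F borel (N t) (\<lambda>\<omega>. distr (Q (\<Theta> \<omega>)) borel (N t))"
    using t by (intro is_cond_distr_distr measurable_N)
  show "kernels_eq_AE P F borel (\<lambda>\<omega>. distr (Q (\<Theta> \<omega>)) borel (N t)) (\<lambda>\<omega>. K t (\<Theta> \<omega>))"
    unfolding kernels_eq_AE_def using AE_restr_F[OF Q] by eventually_elim simp
qed

end

theorem theorem3p12:
  fixes P :: "'a measure" and Z :: "'b measure" and \<Theta> :: "'a \<Rightarrow> 'b"
    and Q :: "'b \<Rightarrow> 'a measure" and N :: "real \<Rightarrow> 'a \<Rightarrow> ennreal"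
    and K :: "real \<Rightarrow> 'b \<Rightarrow> ennreal measure"
  assumes "prob_space P"
    and "\<Theta> \<in> P \<rightarrow>\<^sub>M Z"
    and "disintegration P Z \<Theta> Q"
    and "counting_process P N"
    and "\<And>t. 0 \<le> t \<Longrightarrow> K t \<in> Z \<rightarrow>\<^sub>M prob_algebra borel"
    and "\<And>\<theta> B. \<theta> \<in> space Z \<Longrightarrow> B \<in> sets borel \<Longrightarrow>
           continuous_on {0..} (\<lambda>t. measure (K t \<theta>) B)"
  shows "(cond_stationary_increments P Z \<Theta> N \<and>
          cond_independent_increments P Z \<Theta> N \<and>
          (\<forall>t\<ge>0. \<exists>k. is_cond_distr P (sigma_gen P Z \<Theta>) borel (N t) k \<and>
                     kernels_eq_AE P (sigma_gen P Z \<Theta>) borel k (\<lambda>\<omega>. K t (\<Theta> \<omega>))))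
     \<longleftrightarrow> (AE \<theta> in distr P Z \<Theta>.
            stationary_increments (Q \<theta>) N \<and>
            independent_increments (Q \<theta>) N \<and>
            (\<forall>t\<ge>0. distr (Q \<theta>) borel (N t) = K t \<theta>))"
proof -
  have dc: "disintegrated_counting P N Z \<Theta> Q"
    using assms(1-4)
    by (intro disintegrated_counting.intro counting_prob.intro counting.intro
        disintegrated_counting_axioms.intro)
  interpret disintegrated_counting P N Z \<Theta> Q by (rule dc)
  show ?thesis (is "?L \<longleftrightarrow> ?R")
  proof
    assume ?L
    then show ?R
      using AE_stationary_increments_Q AE_independent_increments_Q AE_distr_Q[of K] assms(5,6)
      by (intro AE_conjI) auto
  next
    assume R: ?R
    from R have "AE \<theta> in distr P Z \<Theta>. stationary_increments (Q \<theta>) N"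
      by eventually_elim blast
    moreover from R have "AE \<theta> in distr P Z \<Theta>. independent_increments (Q \<theta>) N"
      by eventually_elim blast
    \<comment> \<open>The conditional statement treats each time separately, so here the null set
      may depend on \<open>t\<close>.\<close>
    moreover have "AE \<theta> in distr P Z \<Theta>. distr (Q \<theta>) borel (N t) = K t \<theta>" if "0 \<le> t" for t
      using R by eventually_elim (use that in blast)
    ultimately show ?L
      using cond_stationary_incrementsI cond_independent_incrementsI cond_distr_N[of _ K] by blast
  qed
qed

end
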